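(* For every $k\in\mathbb{N}$ and every $n\in\mathbb{N}$ there is a vector $x\in c_{00}$ such that $\|x\|_{\ell_1}=1$ and \[ \frac{\|x\|_{k+1}}{\|x\|_k}\ge \frac{n}{4}.\] Hence, for every $k\in\mathbb{N}$, \[ \sup\left\{ \frac{\|x\|_{k+1}}{\|x\|_k} \ : \ x\in c_{00},\ \|x\|_{\ell_1}=1\right\}=\infty .\]
   Context: $c_{00}$ denotes the vector space of finitely supported real sequences, with canonical basis $(t_n)_{n\ge 1}$; for $x=\sum_n a_nt_n$, $\|x\|_{\ell_1}=\sum_n|a_n|$. For finite nonempty $E,F\subset\mathbb{N}$ write $E<F$ if $\max E<\min F$, and $k\le E$ if $k\le\min E$; for $x=\sum_n a_nt_n$ put $Ex=\sum_{n\in E}a_nt_n$. The iterates of the Tsirelson (Figiel–Johnson) norm are defined by $\|x\|_0=\max_n|a_n|$ and, for $m\ge 0$, \[ \|x\|_{m+1}=\max\Big\{\|x\|_m,\ \max\Big\{\tfrac12\sum_{i=1}^{k}\|E_ix\|_m : k\in\mathbb{N},\ k\le E_1<E_2<\dots<E_k\Big\}\Big\}. \] $\|\cdot\|_m$ is called the $m$-th iterate in the construction of the Tsirelson norm. *)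

theory Defs
  imports Complex_Main "HOL-Library.Extended_Real"
begin

text \<open>
  Sequences are indexed by \<open>n \<ge> 1\<close>, as the condition \<open>k \<le> E\<close> below depends on the indexing.
  They are encoded as functions on type \<open>nat\<close> whose value at the unused index \<open>0\<close> is \<open>0\<close>.
\<close>

definition c00 :: "(nat \<Rightarrow> real) set" where
  "c00 = {x. x 0 = 0 \<and> finite {n. x n \<noteq> 0}}"

definition l1_norm :: "(nat \<Rightarrow> real) \<Rightarrow> real" where
  "l1_norm x = (\<Sum>n | x n \<noteq> 0. \<bar>x n\<bar>)"

definition set_proj :: "nat set \<Rightarrow> (nat \<Rightarrow> real) \<Rightarrow> nat \<Rightarrow> real" where
  "set_proj E x = (\<lambda>n. if n \<in> E then x n else 0)"

definition block_less :: "nat set \<Rightarrow> nat set \<Rightarrow> bool" where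
  "block_less E F \<longleftrightarrow> Max E < Min F"

text \<open>\<open>k \<le> E 1 < E 2 < \<dots> < E k\<close>; the values of \<open>E\<close> outside \<open>{1..k}\<close> are irrelevant.\<close>

definition admissible :: "nat \<Rightarrow> (nat \<Rightarrow> nat set) \<Rightarrow> bool" where
  "admissible k E \<longleftrightarrow>
     1 \<le> k \<and>
     (\<forall>i\<in>{1..k}. finite (E i) \<and> E i \<noteq> {} \<and> E i \<subseteq> {1..}) \<and>
     k \<le> Min (E 1) \<and>
     (\<forall>i\<in>{1..<k}. block_less (E i) (E (Suc i)))"

text \<open>
  On \<^term>\<open>c00\<close>, which is closed under \<^const>\<open>set_proj\<close>, both \<^const>\<open>Max\<close> operators range over
  finite nonempty sets; see \<open>set_proj_c00\<close>, \<open>iter_norm_0_wf\<close> and \<open>iter_norm_Suc_wf\<close>.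
\<close>

primrec iter_norm :: "nat \<Rightarrow> (nat \<Rightarrow> real) \<Rightarrow> real" where
  "iter_norm 0 x = Max ((\<lambda>n. \<bar>x n\<bar>) ` {1..})"
| "iter_norm (Suc m) x =
     max (iter_norm m x)
         (Max {(1/2) * (\<Sum>i=1..k. iter_norm m (set_proj (E i) x)) | k E. admissible k E})"

lemma admissible_singleton: "admissible 1 (\<lambda>_. {1})"
  by (auto simp: admissible_def)

lemma set_proj_c00:
  assumes "x \<in> c00"
  shows "set_proj E x \<in> c00"
proof -
  have "{n. set_proj E x n \<noteq> 0} \<subseteq> {n. x n \<noteq> 0}" by (auto simp: set_proj_def)
  with assms show ?thesis
    by (auto simp: c00_def set_proj_def intro: finite_subset)
qed

lemma iter_norm_0_wf:
  assumes "x \<in> c00"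
  shows "finite ((\<lambda>n. \<bar>x n\<bar>) ` {1..})" and "(\<lambda>n. \<bar>x n\<bar>) ` {1::nat..} \<noteq> {}"
proof -
  have "(\<lambda>n. \<bar>x n\<bar>) ` {1..} \<subseteq> insert 0 ((\<lambda>n. \<bar>x n\<bar>) ` {n. x n \<noteq> 0})"
    by auto
  moreover have "finite (insert 0 ((\<lambda>n. \<bar>x n\<bar>) ` {n. x n \<noteq> 0}))"
    using assms by (simp add: c00_def)
  ultimately show "finite ((\<lambda>n. \<bar>x n\<bar>) ` {1..})" by (rule finite_subset)
qed auto

lemma iter_norm_zero: "iter_norm m (\<lambda>_. 0) = 0"
proof (induction m)
  case 0
  have "(\<lambda>n. \<bar>0::real\<bar>) ` {1::nat..} = {0}" by auto
  then show ?case by simp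
next
  case (Suc m)
  have p: "set_proj A (\<lambda>_. 0) = (\<lambda>_. 0)" for A by (auto simp: set_proj_def)
  have "{(1/2) * (\<Sum>i=1..k. iter_norm m (set_proj (E i) (\<lambda>_. 0))) | k E. admissible k E} = {0}"
    using admissible_singleton by (auto simp: p Suc.IH)
  then show ?case by (simp add: Suc.IH)
qed

lemma admissible_Max_less_Min:
  assumes "admissible k E" and "1 \<le> i" and "i < j" and "j \<le> k"
  shows "Max (E i) < Min (E j)"
  using assms(3,4)
proof (induction j)
  case (Suc j)
  have step: "Max (E j) < Min (E (Suc j))"
  proof -
    have "j \<in> {1..<k}" using assms(2) Suc.prems by auto
    then show ?thesis using assms(1) unfolding admissible_def block_less_def by blast
  qed
  show ?case
  proof (cases "i = j")
    case False
    then have "Max (E i) < Min (E j)" using Suc by auto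
    also have "Min (E j) \<le> Max (E j)"
      using assms(1,2) Suc.prems by (intro Min_le Max_in) (auto simp: admissible_def)
    finally show ?thesis using step by linarith
  qed (use step in simp)
qed simp

lemma admissible_disjoint:
  assumes "admissible k E" and "i \<in> {1..k}" and "j \<in> {1..k}" and "i \<noteq> j"
  shows "E i \<inter> E j = {}"
proof -
  have *: "E a \<inter> E b = {}" if ab: "1 \<le> a" "a < b" "b \<le> k" for a b
  proof -
    have "finite (E a)" "finite (E b)" using assms(1) ab by (auto simp: admissible_def)
    moreover have "Max (E a) < Min (E b)"
      using admissible_Max_less_Min[OF assms(1)] ab by blast
    ultimately show ?thesis
      by (meson Max_ge Min_le disjoint_iff le_less_trans not_less order.trans)
  qed
  show ?thesis
    using *[of i j] *[of j i] assms(2-4) by (cases "i < j") auto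
qed

lemma iter_norm_Suc_wf:
  assumes "x \<in> c00"
  shows "finite {(1/2) * (\<Sum>i=1..k. iter_norm m (set_proj (E i) x)) | k E. admissible k E}"
      (is "finite ?V")
    and "{(1/2) * (\<Sum>i=1..k. iter_norm m (set_proj (E i) x)) | k E. admissible k E} \<noteq> {}"
proof -
  define S where "S = {n. x n \<noteq> 0}"
  have S: "finite S" using assms by (simp add: S_def c00_def)
  define f where "f A = iter_norm m (set_proj A x)" for A
  have f_int: "f A = f (A \<inter> S)" for A
    unfolding f_def by (rule arg_cong[where f = "iter_norm m"]) (auto simp: set_proj_def S_def)
  have f_empty: "f {} = 0"
    unfolding f_def by (simp add: set_proj_def iter_norm_zero)
  have "?V \<subseteq> (\<lambda>P. (1/2) * sum f P) ` Pow (Pow S)"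
  proof
    fix v assume "v \<in> ?V"
    then obtain k E where v: "v = (1/2) * (\<Sum>i=1..k. f (E i))" and adm: "admissible k E"
      by (auto simp: f_def)
    define I where "I = {i \<in> {1..k}. E i \<inter> S \<noteq> {}}"
    have inj: "inj_on (\<lambda>i. E i \<inter> S) I"
    proof (rule inj_onI, rule ccontr)
      fix i j assume ij: "i \<in> I" "j \<in> I" "E i \<inter> S = E j \<inter> S" "i \<noteq> j"
      then have "E i \<inter> E j = {}"
        using admissible_disjoint[OF adm, of i j] by (auto simp: I_def)
      with ij show False by (auto simp: I_def)
    qed
    have "(\<Sum>i=1..k. f (E i)) = (\<Sum>i=1..k. f (E i \<inter> S))"
      by (rule sum.cong[OF refl f_int])
    also have "\<dots> = (\<Sum>i\<in>I. f (E i \<inter> S))"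
      by (rule sum.mono_neutral_right) (auto simp: I_def f_empty)
    also have "\<dots> = sum f ((\<lambda>i. E i \<inter> S) ` I)"
      using inj by (simp add: sum.reindex)
    finally have "v = (1/2) * sum f ((\<lambda>i. E i \<inter> S) ` I)"
      unfolding v by simp
    moreover have "(\<lambda>i. E i \<inter> S) ` I \<in> Pow (Pow S)" by blast
    ultimately show "v \<in> (\<lambda>P. (1/2) * sum f P) ` Pow (Pow S)"
      by (rule image_eqI)
  qed
  then show "finite ?V"
    using S by (meson finite_Pow_iff finite_imageI finite_subset)
  show "?V \<noteq> {}" using admissible_singleton by blast
qed

end

theory Submission
  imports Defs
begin

text \<open>
  A functional attaining the \<open>k\<close>-th iterate is carried by a set of the \<open>k\<close>-th Schreier family, so
  \<open>\<parallel>x\<parallel>\<^sub>k\<close> is at most the largest \<open>\<ell>\<^sub>1\<close>-mass that \<open>x\<close> puts on such a set. By induction on \<open>k\<close> there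
  are, arbitrarily far out, vectors of prescribed mass \<open>c\<close> for which these masses are at most
  \<open>\<epsilon>\<close> although \<open>\<parallel>x\<parallel>\<^bsub>k+1\<^esub> \<ge> c / 2\<^bsup>k+1\<^esup>\<close>: add up \<open>M\<close> successive vectors of mass \<open>c / M\<close>, supported
  beyond \<open>M\<close>. Each of them is chosen so flat that the union of \<open>n\<close> sets of the \<open>k\<close>-th family sees
  almost nothing of it, for every \<open>n\<close> up to the start of its support. A set of the \<open>(k+1)\<close>-st
  family then sees a substantial part of at most one summand, the first one that it meets.
\<close>

section \<open>Schreier families\<close>

text \<open>
  The members of the union need not be successive: only their number matters for the upper bounds.
\<close>

primrec schreier :: "nat \<Rightarrow> nat set set" where
  "schreier 0 = {F. \<exists>n\<ge>1. F \<subseteq> {n}}"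
| "schreier (Suc k) =
     {\<Union>\<G> | \<G>. finite \<G> \<and> \<G> \<subseteq> schreier k \<and> (\<forall>n\<in>\<Union>\<G>. card \<G> \<le> n)}"

lemma finite_schreier: "F \<in> schreier k \<Longrightarrow> finite F"
  by (induction k arbitrary: F) (auto intro: finite_subset)

lemma zero_notin_schreier: "F \<in> schreier k \<Longrightarrow> 0 \<notin> F"
  by (induction k arbitrary: F) auto

text \<open>Intersecting every member of the union with \<open>F'\<close> can only merge members, so
  their number does not grow.\<close>

lemma schreier_subset: "F \<in> schreier k \<Longrightarrow> F' \<subseteq> F \<Longrightarrow> F' \<in> schreier k"
proof (induction k arbitrary: F F')
  case 0
  then show ?case by auto
next
  case (Suc k)
  then obtain \<G> where G: "F = \<Union>\<G>" "finite \<G>" "\<G> \<subseteq> schreier k" "\<forall>n\<in>\<Union>\<G>. card \<G> \<le> n"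
    by auto
  let ?H = "(\<lambda>A. A \<inter> F') ` \<G>"
  have "F' = \<Union>?H" using Suc.prems(2) G(1) by auto
  moreover have "finite ?H" using G(2) by simp
  moreover have "?H \<subseteq> schreier k" using G(3) Suc.IH by (auto intro: Int_lower1)
  moreover have "\<forall>n\<in>\<Union>?H. card ?H \<le> n"
    using G(4) card_image_le[OF G(2), of "\<lambda>A. A \<inter> F'"] by (auto intro: order_trans)
  ultimately show ?case by (simp only: schreier.simps mem_Collect_eq) blast
qed

text \<open>The family \<open>{F}\<close> works: its condition \<open>1 \<le> n\<close> excludes
  only the index 0.\<close>

lemma schreier_Suc_mono: "F \<in> schreier k \<Longrightarrow> F \<in> schreier (Suc k)"
  using zero_notin_schreier[of F k]
  by (auto intro!: exI[of _ "{F}"] simp: Suc_le_eq) (metis gr0I)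

section \<open>Upper bounds for the iterates by masses on Schreier sets\<close>

lemma admissible_le_mem:
  assumes "admissible k E" "i \<in> {1..k}" "n \<in> E i"
  shows "k \<le> n"
proof -
  have fin: "finite (E j)" "E j \<noteq> {}" if "j \<in> {1..k}" for j
    using assms(1) that by (auto simp: admissible_def)
  have "k \<le> Min (E 1)" using assms(1) by (simp add: admissible_def)
  also have "Min (E 1) \<le> Min (E i)"
  proof (cases "i = 1")
    case False
    then have "Max (E 1) < Min (E i)"
      using admissible_Max_less_Min[OF assms(1), of 1 i] assms(2) by simp
    moreover have "Min (E 1) \<le> Max (E 1)"
      using fin[of 1] assms(2) by (intro Min_le Max_in) auto
    ultimately show ?thesis by simp
  qed simp
  also have "Min (E i) \<le> n" using fin[OF assms(2)] assms(3) by simp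
  finally show ?thesis .
qed

text \<open>The sets obtained for the summands of an optimal admissible sum combine into one set of
  the next family. The factor 1/2 is merely bounded by 1; this loss is harmless, as the masses will
  be made arbitrarily small.\<close>

lemma iter_norm_le_schreier:
  "x \<in> c00 \<Longrightarrow> \<exists>F\<in>schreier k. iter_norm k x \<le> (\<Sum>n\<in>F. \<bar>x n\<bar>)"
proof (induction k arbitrary: x)
  case 0
  obtain n where "n \<ge> 1" "iter_norm 0 x = \<bar>x n\<bar>"
    using Max_in[OF iter_norm_0_wf[OF 0]] by auto
  then show ?case by (intro bexI[of _ "{n}"]) auto
next
  case (Suc m)
  let ?V = "{(1/2) * (\<Sum>i=1..k. iter_norm m (set_proj (E i) x)) | k E. admissible k E}"
  consider "iter_norm (Suc m) x = iter_norm m x" | "iter_norm (Suc m) x = Max ?V"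
    unfolding iter_norm.simps max_def by metis
  then show ?case
  proof cases
    case 1
    then show ?thesis using Suc.IH[OF Suc.prems] schreier_Suc_mono by metis
  next
    case 2
    have "Max ?V \<in> ?V" by (rule Max_in[OF iter_norm_Suc_wf[OF Suc.prems]])
    then obtain k E where adm: "admissible k E"
      and eq: "iter_norm (Suc m) x = (1/2) * (\<Sum>i=1..k. iter_norm m (set_proj (E i) x))"
      using 2 by auto
    have "\<forall>i. \<exists>F\<in>schreier m. iter_norm m (set_proj (E i) x) \<le> (\<Sum>n\<in>F. \<bar>set_proj (E i) x n\<bar>)"
      using Suc.IH set_proj_c00[OF Suc.prems] by blast
    then obtain F where F: "\<And>i. F i \<in> schreier m"
      "\<And>i. iter_norm m (set_proj (E i) x) \<le> (\<Sum>n\<in>F i. \<bar>set_proj (E i) x n\<bar>)"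
      by metis
    \<comment> \<open>Cutting down to \<open>E i\<close> makes the pieces disjoint and puts them
      beyond \<open>k\<close>, while \<open>set_proj (E i) x\<close> has no mass elsewhere.\<close>
    define G where "G i = F i \<inter> E i" for i
    have G: "G i \<in> schreier m" for i
      unfolding G_def using F(1)[of i] by (rule schreier_subset) simp
    have G_le: "iter_norm m (set_proj (E i) x) \<le> (\<Sum>n\<in>G i. \<bar>x n\<bar>)" for i
    proof -
      have "(\<Sum>n\<in>F i. \<bar>set_proj (E i) x n\<bar>) = (\<Sum>n\<in>G i. \<bar>set_proj (E i) x n\<bar>)"
        using finite_schreier[OF F(1)]
        by (intro sum.mono_neutral_right) (auto simp: G_def set_proj_def)
      also have "\<dots> = (\<Sum>n\<in>G i. \<bar>x n\<bar>)"
        by (intro sum.cong) (auto simp: G_def set_proj_def)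
      finally show ?thesis using F(2)[of i] by simp
    qed
    let ?U = "\<Union>(G ` {1..k})"
    have U_nonneg: "0 \<le> (\<Sum>n\<in>?U. \<bar>x n\<bar>)" by (simp add: sum_nonneg)
    have "(\<Sum>i=1..k. iter_norm m (set_proj (E i) x)) \<le> (\<Sum>i=1..k. \<Sum>n\<in>G i. \<bar>x n\<bar>)"
      by (intro sum_mono G_le)
    also have "\<dots> = (\<Sum>n\<in>?U. \<bar>x n\<bar>)"
    proof (rule sum.UNION_disjoint[symmetric])
      show "\<forall>i\<in>{1..k}. \<forall>j\<in>{1..k}. i \<noteq> j \<longrightarrow> G i \<inter> G j = {}"
        using admissible_disjoint[OF adm] by (fastforce simp: G_def)
    qed (use finite_schreier[OF G] in auto)
    finally have "iter_norm (Suc m) x \<le> (\<Sum>n\<in>?U. \<bar>x n\<bar>)"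
      using eq U_nonneg by linarith
    moreover have "?U \<in> schreier (Suc m)"
    proof -
      \<comment> \<open>Empty pieces may coincide, so there can be fewer than \<open>k\<close>
        members; an upper bound suffices.\<close>
      have "card (G ` {1..k}) \<le> n" if "n \<in> ?U" for n
        using that admissible_le_mem[OF adm] card_image_le[of "{1..k}" G]
        by (fastforce simp: G_def intro: order_trans)
      then show ?thesis
        unfolding schreier.simps mem_Collect_eq using G by (intro exI[of _ "G ` {1..k}"]) blast
    qed
    ultimately show ?thesis by blast
  qed
qed

section \<open>Lower bounds for the iterates\<close>

lemma abs_le_iter_norm:
  assumes "x \<in> c00" "1 \<le> n"
  shows "\<bar>x n\<bar> \<le> iter_norm k x"
proof (induction k)
  case 0
  show ?case using iter_norm_0_wf[OF assms(1)] assms(2) by simp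
qed simp

lemma iter_norm_Suc_ge_admissible:
  assumes "x \<in> c00" "admissible k E"
  shows "(1/2) * (\<Sum>i=1..k. iter_norm m (set_proj (E i) x)) \<le> iter_norm (Suc m) x"
  unfolding iter_norm.simps using assms
  by (intro max.coboundedI2 Max_ge iter_norm_Suc_wf) blast+

lemma iter_norm_Suc_ge_intervals:
  assumes "x \<in> c00" "strict_mono a" "1 \<le> M" "M \<le> a 0"
  shows "(1/2) * (\<Sum>j<M. iter_norm m (set_proj {a j..<a (Suc j)} x)) \<le> iter_norm (Suc m) x"
proof -
  \<comment> \<open>\<open>admissible\<close> counts its sets from 1, whereas \<open>a\<close>
    starts at 0.\<close>
  define E where "E i = {a (i - 1)..<a i}" for i
  have less: "a (i - 1) < a i" if "1 \<le> i" for i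
    using assms(2) that by (simp add: strict_mono_def)
  have M_le: "M \<le> a i" for i
    using strict_mono_less_eq[OF assms(2), of 0 i] assms(4) by simp
  have Min: "Min (E i) = a (i - 1)" if "1 \<le> i" for i
    unfolding E_def using less[OF that] by (intro Min_eqI) auto
  have Max: "Max (E i) < a i" if "1 \<le> i" for i
    using Max_in[of "E i"] less[OF that] by (auto simp: E_def)
  have "admissible M E"
    unfolding admissible_def block_less_def
  proof (intro conjI ballI)
    fix i assume i: "i \<in> {1..M}"
    show "finite (E i)" by (simp add: E_def)
    show "E i \<noteq> {}" using less[of i] i by (auto simp: E_def)
    show "E i \<subseteq> {1..}" using M_le[of "i - 1"] assms(3) by (auto simp: E_def)
  next
    fix i assume "i \<in> {1..<M}"
    then show "Max (E i) < Min (E (Suc i))" using Min[of "Suc i"] Max[of i] by simp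
  qed (use assms M_le Min in auto)
  from iter_norm_Suc_ge_admissible[OF assms(1) this, of m]
  show ?thesis
    by (simp add: E_def sum.atLeast1_atMost_eq)
qed

section \<open>Vectors that are flat on Schreier sets\<close>

text \<open>The lower bound loses a factor 1/2 at each of the \<open>Suc k\<close> levels. The mass
  \<open>c\<close> stays free because the induction glues vectors of mass
  \<open>c / M\<close>.\<close>

definition schreier_flat ::
    "nat \<Rightarrow> real \<Rightarrow> real \<Rightarrow> nat \<Rightarrow> nat \<Rightarrow> (nat \<Rightarrow> real) \<Rightarrow> bool" where
  "schreier_flat k c \<epsilon> a b x \<longleftrightarrow>
     (\<forall>n. 0 \<le> x n) \<and> (\<forall>n. n \<notin> {a..<b} \<longrightarrow> x n = 0) \<and> sum x {a..<b} = c \<and>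
     c / 2 ^ Suc k \<le> iter_norm (Suc k) x \<and> (\<forall>F\<in>schreier k. sum x F \<le> \<epsilon>)"

lemma c00I_interval: "(\<And>n. n \<notin> {a..<b} \<Longrightarrow> x n = 0) \<Longrightarrow> 1 \<le> a \<Longrightarrow> x \<in> c00"
  unfolding c00_def mem_Collect_eq
  by (intro conjI finite_subset[of "{n. x n \<noteq> 0}" "{a..<b}"]) force+

lemma sum_le_sum_interval:
  fixes x :: "nat \<Rightarrow> real"
  assumes "\<And>n. 0 \<le> x n" "\<And>n. n \<notin> {a..<b} \<Longrightarrow> x n = 0" "finite F"
  shows "sum x F \<le> sum x {a..<b}"
proof -
  have "sum x F = sum x (F \<inter> {a..<b})"
    using assms(2,3) by (intro sum.mono_neutral_right) auto
  also have "\<dots> \<le> sum x {a..<b}" using assms(1) by (intro sum_mono2) auto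
  finally show ?thesis .
qed

lemma sum_Union_le:
  fixes x :: "'a \<Rightarrow> real"
  assumes "finite \<G>" "\<And>G. G \<in> \<G> \<Longrightarrow> finite G" "\<And>n. 0 \<le> x n"
  shows "sum x (\<Union>\<G>) \<le> (\<Sum>G\<in>\<G>. sum x G)"
  using assms(1,2)
proof (induction \<G> rule: finite_induct)
  case (insert A \<G>)
  have "sum x (A \<union> \<Union>\<G>) \<le> sum x A + sum x (\<Union>\<G>)"
    using insert.hyps insert.prems assms(3) sum_nonneg[of "A \<inter> \<Union>\<G>" x]
      sum.union_inter[of A "\<Union>\<G>" x] by auto
  then show ?case using insert by fastforce
qed simp

text \<open>The mass is spread evenly over \<open>M\<close> coordinates starting at
  \<open>M\<close>. Their singletons are admissible and give \<open>c / 2\<close>, while a set of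
  level 0 sees at most one entry \<open>c / M\<close>.\<close>

lemma ex_schreier_flat_0:
  assumes "0 < c" "0 < \<epsilon>" "1 \<le> a"
  shows "\<exists>b x. schreier_flat 0 c \<epsilon> a b x"
proof -
  obtain L where L: "c / \<epsilon> < real L" using reals_Archimedean2 by blast
  \<comment> \<open>\<open>M \<ge> a\<close> keeps the support to the right of \<open>a\<close>, and
    \<open>M \<ge> L\<close> makes each entry at most \<open>\<epsilon>\<close>.\<close>
  define M where "M = max a L"
  have M: "1 \<le> M" "a \<le> M" "c / M \<le> \<epsilon>"
  proof -
    have "c / \<epsilon> \<le> real M" using L by (simp add: M_def)
    then show "c / M \<le> \<epsilon>" using assms by (simp add: M_def field_simps)
  qed (use assms in \<open>auto simp: M_def\<close>)
  define x where "x n = (if n \<in> {M..<M+M} then c / M else 0)" for n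
  have x0: "x n = 0" if "n \<notin> {a..<M+M}" for n using that M by (auto simp: x_def)
  have c00: "x \<in> c00" using x0 assms(3) by (rule c00I_interval)
  have "sum x {a..<M+M} = sum x {M..<M+M}"
    using M by (intro sum.mono_neutral_right) (auto simp: x_def)
  then have sum: "sum x {a..<M+M} = c" using M by (simp add: x_def)
  have "(1/2) * (\<Sum>j<M. iter_norm 0 (set_proj {M + j..<M + Suc j} x)) \<le> iter_norm (Suc 0) x"
    using c00 M by (intro iter_norm_Suc_ge_intervals) (auto simp: strict_mono_def)
  moreover have "(\<Sum>j<M. c / M) \<le> (\<Sum>j<M. iter_norm 0 (set_proj {M + j..<M + Suc j} x))"
  proof (rule sum_mono)
    fix j assume "j \<in> {..<M}"
    then show "c / M \<le> iter_norm 0 (set_proj {M + j..<M + Suc j} x)"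
      using abs_le_iter_norm[OF set_proj_c00[OF c00], of "M + j" "{M + j..<M + Suc j}" 0] M assms(1)
      by (simp add: set_proj_def x_def del: iter_norm.simps)
  qed
  ultimately have norm: "c / 2 ^ Suc 0 \<le> iter_norm (Suc 0) x"
    using M by (simp del: iter_norm.simps)
  have "sum x F \<le> \<epsilon>" if F: "F \<in> schreier 0" for F
  proof -
    obtain n where "F \<subseteq> {n}" using F by auto
    then have "F = {} \<or> F = {n}" by (rule subset_singletonD)
    then show ?thesis using M(3) assms(2) by (auto simp: x_def)
  qed
  then show ?thesis
    unfolding schreier_flat_def using x0 sum norm assms(1)
    by (intro exI[of _ "M+M"] exI[of _ x] conjI) (auto simp: x_def)
qed

text \<open>The start \<open>a\<close> is prescribed before the vector is chosen, so in the
  induction the tolerance of a block may depend on where it starts.\<close>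

lemma ex_schreier_flat:
  assumes "0 < c" "0 < \<epsilon>" "1 \<le> a"
  shows "\<exists>b x. schreier_flat k c \<epsilon> a b x"
  using assms
proof (induction k arbitrary: c \<epsilon> a)
  case 0
  then show ?case by (rule ex_schreier_flat_0)
next
  case (Suc k)
  obtain L where L: "2 * c / \<epsilon> < real L" using reals_Archimedean2 by blast
  \<comment> \<open>One block may be seen completely; this \<open>M\<close> makes its mass at most
    half of \<open>\<epsilon>\<close>.\<close>
  define M where "M = max 1 L"
  have M: "1 \<le> M" "c / M \<le> \<epsilon> / 2"
  proof -
    have "2 * c / \<epsilon> \<le> real M" using L by (simp add: M_def)
    then show "c / M \<le> \<epsilon> / 2" using Suc.prems by (simp add: M_def field_simps)
  qed (simp add: M_def)
  define s where "s = max a M"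
  \<comment> \<open>With this tolerance, \<open>n\<close> sets of the \<open>k\<close>-th family
    together see at most \<open>\<epsilon> / (2 * M)\<close> of a block starting at
    \<open>n\<close>.\<close>
  have "\<exists>b x. schreier_flat k (c / M) (\<epsilon> / (2 * M * n)) n b x" if "1 \<le> n" for n
    using Suc.prems M that by (intro Suc.IH) auto
  then obtain B X where BX:
    "\<And>n. 1 \<le> n \<Longrightarrow> schreier_flat k (c / M) (\<epsilon> / (2 * M * n)) n (B n) (X n)"
    by metis
  have B: "n < B n" if "1 \<le> n" for n
  proof (rule ccontr)
    assume "\<not> n < B n"
    then have "c / M = 0" using BX[OF that] by (simp add: schreier_flat_def)
    then show False using Suc.prems M by simp
  qed
  \<comment> \<open>Each block begins where the previous one ends. Since \<open>s \<ge> M\<close>,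
    the first \<open>M\<close> blocks are admissible.\<close>
  define p where "p j = (B ^^ j) s" for j
  define y where "y j = X (p j)" for j
  have p_Suc: "p (Suc j) = B (p j)" for j by (simp add: p_def)
  have p1: "1 \<le> p j" for j
  proof (induction j)
    case 0
    then show ?case using M by (simp add: p_def s_def)
  next
    case (Suc j)
    then show ?case using B[of "p j"] by (simp add: p_Suc)
  qed
  have mono: "strict_mono p" unfolding strict_mono_Suc_iff using B p1 by (simp add: p_Suc)
  have y_nonneg: "0 \<le> y j n"
    and y_zero: "n \<notin> {p j..<p (Suc j)} \<Longrightarrow> y j n = 0"
    and y_sum: "sum (y j) {p j..<p (Suc j)} = c / M"
    and y_norm: "c / M / 2 ^ Suc k \<le> iter_norm (Suc k) (y j)"
    and y_flat: "F \<in> schreier k \<Longrightarrow> sum (y j) F \<le> \<epsilon> / (2 * M * p j)" for j n F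
    using BX[OF p1[of j]] unfolding schreier_flat_def y_def p_Suc by blast+
  have y_sum_le: "sum (y j) F \<le> c / M" if "finite F" for j F
  proof -
    have "sum (y j) F \<le> sum (y j) {p j..<p (Suc j)}"
      by (rule sum_le_sum_interval[OF y_nonneg y_zero that])
    then show ?thesis unfolding y_sum .
  qed
  define x where "x n = (\<Sum>j<M. y j n)" for n
  have x_zero: "x n = 0" if "n \<notin> {a..<p M}" for n
  proof -
    have "y j n = 0" if "j < M" for j
    proof (rule y_zero)
      have "a \<le> p j" using strict_mono_less_eq[OF mono, of 0 j] by (simp add: p_def s_def)
      moreover have "p (Suc j) \<le> p M" using strict_mono_less_eq[OF mono] that by simp
      ultimately show "n \<notin> {p j..<p (Suc j)}" using \<open>n \<notin> {a..<p M}\<close> by auto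
    qed
    then show ?thesis by (simp add: x_def)
  qed
  have c00: "x \<in> c00" using x_zero Suc.prems(3) by (rule c00I_interval)
  have proj: "set_proj {p j..<p (Suc j)} x = y j" if "j < M" for j
  proof
    fix n
    show "set_proj {p j..<p (Suc j)} x n = y j n"
    proof (cases "n \<in> {p j..<p (Suc j)}")
      case True
      have "y i n = 0" if "i \<noteq> j" for i
      proof (rule y_zero)
        have "p (Suc i) \<le> p j \<or> p (Suc j) \<le> p i"
          using that strict_mono_less_eq[OF mono] by (metis Suc_leI nat_neq_iff)
        then show "n \<notin> {p i..<p (Suc i)}" using True by auto
      qed
      then have "x n = (\<Sum>i\<in>{j}. y i n)"
        unfolding x_def using that by (intro sum.mono_neutral_right) auto
      then show ?thesis using True by (simp add: set_proj_def)
    next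
      case False
      then show ?thesis using y_zero by (simp add: set_proj_def del: atLeastLessThan_iff)
    qed
  qed
  have "sum x {a..<p M} = (\<Sum>j<M. sum (y j) {a..<p M})"
    unfolding x_def by (rule sum.swap)
  also have "\<dots> = (\<Sum>j<M. c / M)"
  proof (rule sum.cong)
    fix j assume "j \<in> {..<M}"
    then have "a \<le> p j" "p (Suc j) \<le> p M"
      using strict_mono_less_eq[OF mono, of 0 j] strict_mono_less_eq[OF mono, of "Suc j" M]
      by (auto simp: p_def s_def)
    then have "sum (y j) {a..<p M} = sum (y j) {p j..<p (Suc j)}"
      by (intro sum.mono_neutral_right ballI y_zero) auto
    then show "sum (y j) {a..<p M} = c / M" by (simp add: y_sum)
  qed simp
  finally have x_sum: "sum x {a..<p M} = c" using M by simp
  \<comment> \<open>The norms of the \<open>M\<close> blocks add up at the cost of one more factor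
    1/2.\<close>
  have "c / 2 ^ Suc (Suc k) = (1/2) * (\<Sum>j<M. c / M / 2 ^ Suc k)" using M by simp
  also have "\<dots> \<le> (1/2) * (\<Sum>j<M. iter_norm (Suc k) (set_proj {p j..<p (Suc j)} x))"
    by (intro mult_left_mono sum_mono)
      (use y_norm in \<open>auto simp: proj simp del: iter_norm.simps power_Suc\<close>)
  also have "\<dots> \<le> iter_norm (Suc (Suc k)) x"
    using c00 mono M(1) by (rule iter_norm_Suc_ge_intervals) (simp add: p_def s_def)
  finally have x_norm: "c / 2 ^ Suc (Suc k) \<le> iter_norm (Suc (Suc k)) x" .
  have "sum x F \<le> \<epsilon>" if F: "F \<in> schreier (Suc k)" for F
  proof -
    obtain \<G> where G: "F = \<Union>\<G>" "finite \<G>" "\<G> \<subseteq> schreier k" "\<forall>n\<in>\<Union>\<G>. card \<G> \<le> n"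
      using F by auto
    \<comment> \<open>The only block that may be seen fully. For empty \<open>F\<close> the value is
      arbitrary, but then only the case \<open>disjoint\<close> occurs.\<close>
    define j0 where "j0 = (LEAST j. \<exists>n\<in>F. n < p (Suc j))"
    have y_le: "sum (y j) F \<le> \<epsilon> / (2 * M) + (if j = j0 then c / M else 0)" for j
    proof -
      consider (late) n where "n \<in> F" "n < p j"
        | (first) n where "n \<in> F" "n < p (Suc j)" "\<forall>n\<in>F. p j \<le> n"
        | (disjoint) "\<forall>n\<in>F. p (Suc j) \<le> n"
        by (meson not_le)
      then show ?thesis
      proof cases
        case late
        \<comment> \<open>A point of \<open>F\<close> before block \<open>j\<close> limits the
          number of members of \<open>\<G>\<close> to the number for which \<open>y j\<close> was
          tuned.\<close>
        then have card: "card \<G> \<le> p j" using G(1,4) by fastforce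
        have "sum (y j) F \<le> (\<Sum>A\<in>\<G>. sum (y j) A)"
          unfolding G(1) using G(2,3) finite_schreier y_nonneg by (intro sum_Union_le) auto
        also have "\<dots> \<le> (\<Sum>A\<in>\<G>. \<epsilon> / (2 * M * p j))"
          using G(3) y_flat by (intro sum_mono) auto
        also have "\<dots> = card \<G> * (\<epsilon> / (2 * M * p j))" by simp
        also have "\<dots> \<le> p j * (\<epsilon> / (2 * M * p j))"
          using card Suc.prems by (intro mult_right_mono) auto
        also have "\<dots> = \<epsilon> / (2 * M)" using p1[of j] by simp
        finally show ?thesis using Suc.prems by (auto intro: add_increasing2)
      next
        case first
        \<comment> \<open>\<open>F\<close> starts inside this block, so \<open>card \<G>\<close> may
          exceed \<open>p j\<close> and only the full mass \<open>c / M\<close> is available as a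
          bound.\<close>
        have "j0 = j" unfolding j0_def
        proof (rule Least_equality)
          fix i assume "\<exists>n\<in>F. n < p (Suc i)"
          then have "p j < p (Suc i)" using first(3) by (auto intro: le_less_trans)
          then show "j \<le> i" using strict_mono_less[OF mono] by auto
        qed (use first in auto)
        then show ?thesis
          using y_sum_le[OF finite_schreier[OF F], of j] Suc.prems by (auto intro: add_increasing)
      next
        case disjoint
        then have "sum (y j) F = 0" by (intro sum.neutral ballI y_zero) auto
        then show ?thesis using Suc.prems by simp
      qed
    qed
    have "sum x F = (\<Sum>j<M. sum (y j) F)" unfolding x_def by (rule sum.swap)
    also have "\<dots> \<le> (\<Sum>j<M. \<epsilon> / (2 * M) + (if j = j0 then c / M else 0))"
      by (intro sum_mono y_le)
    also have "\<dots> = \<epsilon> / 2 + (\<Sum>j<M. if j = j0 then c / M else 0)"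
      using M by (simp add: sum.distrib)
    \<comment> \<open>The extra term occurs once, or not at all if
      \<open>j0 \<ge> M\<close>.\<close>
    also have "\<dots> \<le> \<epsilon> / 2 + c / M" using Suc.prems by simp
    also have "\<dots> \<le> \<epsilon>" using M(2) by linarith
    finally show ?thesis .
  qed
  moreover have "0 \<le> x n" for n unfolding x_def by (intro sum_nonneg y_nonneg)
  ultimately show ?case
    unfolding schreier_flat_def using x_zero x_sum x_norm by blast
qed

section \<open>Unbounded ratios of consecutive iterates\<close>

lemma ex_iter_norm_ratio_ge:
  assumes "0 < r"
  shows "\<exists>x\<in>c00. l1_norm x = 1 \<and> r \<le> iter_norm (k + 1) x / iter_norm k x"
proof -
  \<comment> \<open>The numerator will be at least \<open>1 / 2 ^ Suc k\<close>, so this bound on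
    the denominator yields the ratio \<open>r\<close>.\<close>
  let ?\<epsilon> = "1 / (r * 2 ^ Suc k)"
  obtain b x where "schreier_flat k 1 ?\<epsilon> 1 b x"
    using ex_schreier_flat[of 1 ?\<epsilon> 1 k] assms by auto
  then have x: "\<And>n. 0 \<le> x n" "\<And>n. n \<notin> {1..<b} \<Longrightarrow> x n = 0" "sum x {1..<b} = 1"
      "1 / 2 ^ Suc k \<le> iter_norm (Suc k) x" "\<And>F. F \<in> schreier k \<Longrightarrow> sum x F \<le> ?\<epsilon>"
    unfolding schreier_flat_def by blast+
  have c00: "x \<in> c00" by (rule c00I_interval[of 1 b]) (use x(2) in auto)
  have "l1_norm x = sum x {1..<b}"
    unfolding l1_norm_def using x(1,2) by (intro sum.mono_neutral_cong_left) force+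
  then have "l1_norm x = 1" using x(3) by simp
  obtain n where n: "n \<in> {1..<b}" "x n \<noteq> 0"
    using x(3) sum.neutral[of "{1..<b}" x] by fastforce
  \<comment> \<open>Positivity matters, since a quotient by 0 would have the value 0.\<close>
  have pos: "0 < iter_norm k x"
    using abs_le_iter_norm[OF c00, of n k] n by (simp del: iter_norm.simps)
  obtain F where "F \<in> schreier k" "iter_norm k x \<le> (\<Sum>n\<in>F. \<bar>x n\<bar>)"
    using iter_norm_le_schreier[OF c00] by blast
  then have "iter_norm k x \<le> ?\<epsilon>" using x(1) x(5)[of F] by simp
  then have "r * iter_norm k x \<le> 1 / 2 ^ Suc k"
    using assms mult_left_mono[of "iter_norm k x" ?\<epsilon> r] by simp
  also note x(4)
  finally have "r \<le> iter_norm (k + 1) x / iter_norm k x"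
    using pos by (simp add: pos_le_divide_eq del: iter_norm.simps)
  with c00 \<open>l1_norm x = 1\<close> show ?thesis by blast
qed

theorem theorem7p2:
  shows "(\<forall>k n :: nat. \<exists>x\<in>c00. l1_norm x = 1 \<and>
            iter_norm (k + 1) x / iter_norm k x \<ge> real n / 4)
       \<and> (\<forall>k :: nat. (SUP x\<in>{x \<in> c00. l1_norm x = 1}.
            ereal (iter_norm (k + 1) x / iter_norm k x)) = \<infinity>)"
proof (intro conjI allI)
  fix k n :: nat
  \<comment> \<open>Adding 1 keeps the prescribed ratio positive for \<open>n = 0\<close>.\<close>
  obtain x where "x \<in> c00" "l1_norm x = 1" "real n + 1 \<le> iter_norm (k + 1) x / iter_norm k x"
    using ex_iter_norm_ratio_ge[of "real n + 1" k] by auto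
  moreover have "real n / 4 \<le> real n + 1" by simp
  ultimately show "\<exists>x\<in>c00. l1_norm x = 1 \<and> iter_norm (k + 1) x / iter_norm k x \<ge> real n / 4"
    by (meson order_trans)
next
  fix k :: nat
  show "(SUP x\<in>{x \<in> c00. l1_norm x = 1}. ereal (iter_norm (k + 1) x / iter_norm k x)) = \<infinity>"
  proof (rule SUP_PInfty)
    fix n :: nat
    obtain x where "x \<in> c00" "l1_norm x = 1" "real n + 1 \<le> iter_norm (k + 1) x / iter_norm k x"
      using ex_iter_norm_ratio_ge[of "real n + 1" k] by auto
    then show "\<exists>x\<in>{x \<in> c00. l1_norm x = 1}.
        ereal (real n) \<le> ereal (iter_norm (k + 1) x / iter_norm k x)"
      by (intro bexI[of _ x]) auto
  qed
qed

end
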